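(* Let $A=[a_{i,j}]\in\mathcal L$ be a matrix of index zero. Then there exists a sequence of polynomials $\{p_k(t)\}_{k\ge 0}$ (with complex coefficients) such that $p_k(t)$ has degree at most $k$ for every $k\ge 0$, and $$A=\sum_{k\ge 0}\frac{D^k}{k!}\,p_k(X).$$
   Context: All matrices are infinite complex matrices $[a_{j,k}]$ with indices running over the non-negative integers. $\mathcal L$ is the set of all such matrices for which there is an integer $m$ with $a_{j,k}=0$ whenever $j-k<m$; it is an algebra under the usual matrix addition and multiplication (all sums occurring in products are finite). The entry $a_{j,k}$ lies in the $n$-th diagonal if $j-k=n$. The index of a nonzero $A\in\mathcal L$ is the minimum integer $m$ such that $A$ has a nonzero entry in the $m$-th diagonal; thus a matrix of index zero is lower triangular. $X$ is the matrix with $X_{j,j+1}=1$ for $j\ge 0$ and all other entries zero. $D$ is the matrix with $D_{k+1,k}=k+1$ for $k\ge 0$ and all other entries zero. For a polynomial $p(t)=\sum_j c_j t^j$, $p(X)=\sum_j c_jX^j$, with $X^0=I$ the identity matrix. Infinite sums of matrices are taken entrywise; here each entry is a finite sum, since the first $k$ rows of $D^k$ are zero. *)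

theory Defs
  imports Complex_Main "HOL-Library.Groups_Big_Fun" "HOL-Computational_Algebra.Polynomial"
begin

type_synonym cmat = "nat \<Rightarrow> nat \<Rightarrow> complex"

definition mat_L :: "cmat set" where
  "mat_L = {A. \<exists>m::int. \<forall>j k. int j - int k < m \<longrightarrow> A j k = 0}"

definition mat_zero :: cmat where
  "mat_zero = (\<lambda>j k. 0)"

text \<open>
  The minimum exists only for nonzero matrices in \<^const>\<open>mat_L\<close>; for other matrices the
  value is unspecified, so statements about the index have to assume both.
\<close>
definition mat_index :: "cmat \<Rightarrow> int" where
  "mat_index A = (LEAST m. \<exists>j k. int j - int k = m \<and> A j k \<noteq> 0)"

definition mat_id :: cmat where
  "mat_id = (\<lambda>j k. if j = k then 1 else 0)"

text \<open>
  \<^const>\<open>Sum_any\<close> sums over the support of the summand, which is finite for factors in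
  \<^const>\<open>mat_L\<close> (and would yield 0 for an infinite support). It is written without binder
  syntax, which would be ambiguous with \<^const>\<open>suminf\<close>.
\<close>
definition mat_mult :: "cmat \<Rightarrow> cmat \<Rightarrow> cmat" where
  "mat_mult A B = (\<lambda>i j. Sum_any (\<lambda>k. A i k * B k j))"

definition mat_scale :: "complex \<Rightarrow> cmat \<Rightarrow> cmat" where
  "mat_scale c A = (\<lambda>i j. c * A i j)"

primrec mat_pow :: "cmat \<Rightarrow> nat \<Rightarrow> cmat" where
  "mat_pow A 0 = mat_id"
| "mat_pow A (Suc n) = mat_mult A (mat_pow A n)"

definition mat_poly :: "complex poly \<Rightarrow> cmat \<Rightarrow> cmat" where
  "mat_poly p A = (\<lambda>i j. \<Sum>n\<le>degree p. mat_scale (coeff p n) (mat_pow A n) i j)"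

text \<open>Entrywise sum of a sequence of matrices, each entry being a finite sum.\<close>
definition mat_sum :: "(nat \<Rightarrow> cmat) \<Rightarrow> cmat" where
  "mat_sum F = (\<lambda>i j. Sum_any (\<lambda>k. F k i j))"

definition mat_X :: cmat where
  "mat_X = (\<lambda>i j. if j = i + 1 then 1 else 0)"

definition mat_D :: cmat where
  "mat_D = (\<lambda>i j. if i = j + 1 then of_nat i else 0)"

text \<open>The default value 0 of \<^const>\<open>Sum_any\<close> never comes into play below:\<close>

lemma finite_mult_support:
  assumes "A \<in> mat_L"
  shows "finite {k. A i k * B k j \<noteq> 0}"
proof -
  from assms obtain m :: int where m: "\<And>j k. int j - int k < m \<Longrightarrow> A j k = 0"
    by (auto simp: mat_L_def)
  have "{k. A i k * B k j \<noteq> 0} \<subseteq> {..nat (int i - m)}"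
  proof
    fix k assume "k \<in> {k. A i k * B k j \<noteq> 0}"
    then have "A i k \<noteq> 0" by auto
    then have "\<not> int i - int k < m" using m by blast
    then show "k \<in> {..nat (int i - m)}" by auto
  qed
  then show ?thesis by (rule finite_subset) simp
qed

lemma mat_pow_D_eq_0:
  assumes "i < k"
  shows "mat_pow mat_D k i j = 0"
  using assms
proof (induction k arbitrary: i)
  case (Suc k)
  have "mat_D i l * mat_pow mat_D k l j = 0" for l
    using Suc by (auto simp: mat_D_def)
  then show ?case by (simp add: mat_mult_def del: mult_eq_0_iff)
qed simp

lemma finite_D_sum_support:
  "finite {k. mat_mult (mat_scale (c k) (mat_pow mat_D k)) (B k) i j \<noteq> 0}"
proof (rule finite_subset)
  show "{k. mat_mult (mat_scale (c k) (mat_pow mat_D k)) (B k) i j \<noteq> 0} \<subseteq> {..i}"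
  proof
    fix k assume *: "k \<in> {k. mat_mult (mat_scale (c k) (mat_pow mat_D k)) (B k) i j \<noteq> 0}"
    show "k \<in> {..i}"
    proof (rule ccontr)
      assume "k \<notin> {..i}"
      then have "mat_pow mat_D k i l = 0" for l by (simp add: mat_pow_D_eq_0)
      with * show False by (simp add: mat_mult_def mat_scale_def)
    qed
  qed
qed simp

end

theory Submission
  imports Defs
begin

text \<open>
  The matrix \<open>D\<^sup>k / k!\<close> has the entries \<open>i choose k\<close> on its \<open>k\<close>-th diagonal, and
  \<open>p\<^sub>k(X)\<close> is the upper triangular Toeplitz matrix of the coefficients of \<open>p\<^sub>k\<close>.
  For \<open>d \<ge> 0\<close> the entry \<open>(i, i - d)\<close> of the sum is therefore
  \<open>\<Sum>k. (i choose k) * coeff p\<^sub>k (k - d)\<close>: on each diagonal the equation to be solved is a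
  binomial transform, and binomial inversion yields the coefficients. As \<open>A\<close> is lower triangular,
  no coefficients of order above \<open>k\<close> are needed.
\<close>

text \<open>After exchanging the sums, \<open>(n choose k) * (k choose i) = (n choose i) * ((n - i)
  choose (k - i))\<close> leaves an alternating sum of binomial coefficients for each
  \<open>i\<close>, which vanishes unless \<open>i = n\<close>.\<close>

lemma binomial_inversion:
  fixes a :: "nat \<Rightarrow> 'a::comm_ring_1"
  shows "(\<Sum>k\<le>n. of_nat (n choose k) * (\<Sum>i\<le>k. (-1) ^ (k - i) * of_nat (k choose i) * a i)) = a n"
proof -
  have alt: "(\<Sum>k=i..n. of_nat (n choose k) * ((-1) ^ (k - i) * of_nat (k choose i) * a i))
      = (if i = n then a i else 0)" if "i \<le> n" for i
  proof -
    have "(\<Sum>k=i..n. of_nat (n choose k) * ((-1) ^ (k - i) * of_nat (k choose i) * a i))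
        = (\<Sum>k=i..n. of_nat (n choose i) * a i * ((-1) ^ (k - i) * of_nat ((n - i) choose (k - i))))"
    proof (rule sum.cong)
      fix k assume "k \<in> {i..n}"
      then have "(of_nat (n choose k) * of_nat (k choose i) :: 'a)
          = of_nat (n choose i) * of_nat ((n - i) choose (k - i))"
        using choose_mult[of i k n] by (simp flip: of_nat_mult)
      then show "of_nat (n choose k) * ((-1) ^ (k - i) * of_nat (k choose i) * a i)
          = of_nat (n choose i) * a i * ((-1) ^ (k - i) * of_nat ((n - i) choose (k - i)))"
        by (metis (no_types, opaque_lifting) mult.assoc mult.commute)
    qed simp
    also have "\<dots> = of_nat (n choose i) * a i * (\<Sum>m\<le>n - i. (-1) ^ m * of_nat ((n - i) choose m))"
      unfolding sum_distrib_left
      by (rule sum.reindex_bij_witness[of _ "\<lambda>m. m + i" "\<lambda>k. k - i"]) (use that in auto)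
    also have "\<dots> = (if i = n then a i else 0)"
      using that choose_alternating_sum[of "n - i", where ?'a = 'a] by auto
    finally show ?thesis .
  qed
  have "(\<Sum>k\<le>n. of_nat (n choose k) * (\<Sum>i\<le>k. (-1) ^ (k - i) * of_nat (k choose i) * a i))
      = (\<Sum>i\<le>n. \<Sum>k=i..n. of_nat (n choose k) * ((-1) ^ (k - i) * of_nat (k choose i) * a i))"
    unfolding sum_distrib_left sum.Sigma[OF finite_atMost ballI[OF finite_atMost]]
      sum.Sigma[OF finite_atMost ballI[OF finite_atLeastAtMost]]
    by (rule sum.reindex_bij_witness[of _ prod.swap prod.swap]) auto
  also have "\<dots> = (\<Sum>i\<le>n. if i = n then a i else 0)"
    by (intro sum.cong) (simp_all add: alt)
  finally show ?thesis by simp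
qed

text \<open>Rows of \<open>mat_X\<close> and of the powers of \<open>mat_D\<close> have at most one
  nonzero entry, so products with them on the left collapse to one term.\<close>

lemma Sum_any_single:
  assumes "\<And>k. k \<noteq> l \<Longrightarrow> f k = 0"
  shows "Sum_any f = f l"
  using Sum_any.expand_superset[of "{l}" f] assms by auto

lemma mat_pow_X: "mat_pow mat_X n i j = (if j = i + n then 1 else 0)"
proof (induction n arbitrary: i)
  case (Suc n)
  have "mat_pow mat_X (Suc n) i j = mat_X i (Suc i) * mat_pow mat_X n (Suc i) j"
    unfolding mat_pow.simps mat_mult_def by (rule Sum_any_single) (simp add: mat_X_def)
  then show ?case unfolding Suc by (simp add: mat_X_def del: mat_pow.simps)
qed (simp add: mat_id_def)

lemma mat_poly_X: "mat_poly p mat_X i j = (if i \<le> j then coeff p (j - i) else 0)"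
proof -
  have "mat_poly p mat_X i j = (\<Sum>n\<le>degree p. if n = j - i then (if i \<le> j then coeff p n else 0) else 0)"
    unfolding mat_poly_def mat_scale_def mat_pow_X by (rule sum.cong) auto
  then show ?thesis by (simp add: coeff_eq_0)
qed

lemma mat_pow_D: "mat_pow mat_D k i j = (if i = j + k then fact i / fact j else 0)"
proof (induction k arbitrary: i)
  case (Suc k)
  \<comment> \<open>For \<open>i = 0\<close> the truncated \<open>i - 1\<close> is \<open>0\<close>,
    and \<open>mat_D 0 0 = 0\<close> keeps the equation true.\<close>
  have "mat_pow mat_D (Suc k) i j = mat_D i (i - 1) * mat_pow mat_D k (i - 1) j"
    unfolding mat_pow.simps mat_mult_def by (rule Sum_any_single) (simp add: mat_D_def)
  then show ?case unfolding Suc by (cases i) (auto simp: mat_D_def simp del: mat_pow.simps)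
qed (simp add: mat_id_def)

text \<open>For \<open>i < k\<close> the truncated \<open>i - k\<close> is harmless, since the
  binomial coefficient is 0.\<close>

lemma mat_mult_divided_pow_D:
  "mat_mult (mat_scale (1 / fact k) (mat_pow mat_D k)) B i j = of_nat (i choose k) * B (i - k) j"
proof -
  have "mat_mult (mat_scale (1 / fact k) (mat_pow mat_D k)) B i j
      = mat_scale (1 / fact k) (mat_pow mat_D k) i (i - k) * B (i - k) j"
    unfolding mat_mult_def by (rule Sum_any_single) (auto simp: mat_scale_def mat_pow_D)
  also have "mat_scale (1 / fact k) (mat_pow mat_D k) i (i - k) = of_nat (i choose k)"
    by (auto simp: mat_scale_def mat_pow_D binomial_fact binomial_eq_0)
  finally show ?thesis .
qed

lemma mat_sum_divided_pow_D:
  "mat_sum (\<lambda>k. mat_mult (mat_scale (1 / fact k) (mat_pow mat_D k)) (B k)) i j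
    = (\<Sum>k\<le>i. of_nat (i choose k) * B k (i - k) j)"
  unfolding mat_sum_def mat_mult_divided_pow_D
  by (rule Sum_any.expand_superset) (auto simp: not_less intro: ccontr)

lemma mat_index_le:
  assumes "A \<in> mat_L" and "A i j \<noteq> 0"
  shows "mat_index A \<le> int i - int j"
proof -
  obtain m where m: "\<And>j k. int j - int k < m \<Longrightarrow> A j k = 0"
    using assms(1) by (auto simp: mat_L_def)
  let ?P = "\<lambda>x. A (fst x) (snd x) \<noteq> 0"
  let ?d = "\<lambda>x::nat \<times> nat. int (fst x) - int (snd x)"
  \<comment> \<open>The integers are not well-ordered, but membership in \<open>mat_L\<close> bounds
    the differences below by \<open>m\<close>; shifting by \<open>m\<close> gives a minimum over the
    naturals.\<close>
  obtain x where x: "?P x" and min: "\<And>y. ?P y \<Longrightarrow> nat (?d x - m) \<le> nat (?d y - m)"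
    using ex_has_least_nat[of ?P "(i, j)" "\<lambda>x. nat (?d x - m)"] assms(2) by auto
  have le: "?d x \<le> int k - int l" if "A k l \<noteq> 0" for k l
    using min[of "(k, l)"] m[of k l] m[of "fst x" "snd x"] x that by fastforce
  have "mat_index A = ?d x"
    unfolding mat_index_def by (rule Least_equality) (use x le in auto)
  then show ?thesis using le assms(2) by simp
qed

theorem theorem3p1:
  fixes A :: cmat
  assumes "A \<in> mat_L" and "A \<noteq> mat_zero" and "mat_index A = 0"
  shows "\<exists>p :: nat \<Rightarrow> complex poly.
    (\<forall>k. degree (p k) \<le> k) \<and>
    A = mat_sum (\<lambda>k. mat_mult (mat_scale (1 / fact k) (mat_pow mat_D k)) (mat_poly (p k) mat_X))"
proof -
  have upper: "A i j = 0" if "i < j" for i j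
    using mat_index_le[OF assms(1), of i j] assms(3) that by force
  \<comment> \<open>\<open>a d\<close> is the \<open>d\<close>-th diagonal indexed by row and padded
    with zeros, and \<open>b d\<close> is its inverse binomial transform. Coefficient
    \<open>n\<close> of \<open>p k\<close> serves diagonal \<open>k - n\<close>.\<close>
  define a where "a d i = (if d \<le> i then A i (i - d) else 0)" for d i
  define b where "b d k = (\<Sum>i\<le>k. (-1) ^ (k - i) * of_nat (k choose i) * a d i)" for d k
  define p where "p k = (\<Sum>n\<le>k. monom (b (k - n) k) n)" for k
  have coeff_p: "coeff (p k) n = (if n \<le> k then b (k - n) k else 0)" for k n
    by (simp add: p_def coeff_sum)
  have "degree (p k) \<le> k" for k
    by (rule degree_le) (simp add: coeff_p)
  moreover have "A i j = mat_sum (\<lambda>k. mat_mult (mat_scale (1 / fact k) (mat_pow mat_D k))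
      (mat_poly (p k) mat_X)) i j" for i j
  proof (cases "j \<le> i")
    case True
    have b0: "b d k = 0" if "k < d" for d k
      using that by (simp add: b_def a_def)
    have "A i j = (\<Sum>k\<le>i. of_nat (i choose k) * b (i - j) k)"
      using binomial_inversion[where n = i and a = "a (i - j)"] True by (simp add: b_def a_def)
    also have "\<dots> = (\<Sum>k\<le>i. of_nat (i choose k) * mat_poly (p k) mat_X (i - k) j)"
    proof (rule sum.cong)
      fix k assume k: "k \<in> {..i}"
      \<comment> \<open>So the coefficient met at \<open>(i - k, j)\<close> belongs to diagonal
        \<open>i - j\<close>. If instead \<open>j < i - k\<close>, then \<open>k < i - j\<close> and
        both sides vanish by \<open>b0\<close>.\<close>
      have "k - (j - (i - k)) = i - j" if "i - k \<le> j" using that k True by auto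
      then show "of_nat (i choose k) * b (i - j) k = of_nat (i choose k) * mat_poly (p k) mat_X (i - k) j"
        using k True by (auto simp: mat_poly_X coeff_p b0)
    qed simp
    finally show ?thesis by (simp add: mat_sum_divided_pow_D)
  next
    case False
    \<comment> \<open>Above the diagonal the coefficient index \<open>j - (i - k)\<close> exceeds
      \<open>k\<close>, so every term is 0.\<close>
    then show ?thesis
      by (auto simp: mat_sum_divided_pow_D upper mat_poly_X coeff_p intro!: sum.neutral)
  qed
  ultimately show ?thesis by (intro exI[of _ p]) (simp add: fun_eq_iff)
qed

end
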